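(* Let $0<\varepsilon<1$ and let $\omega:\mathbb{N}\to\mathbb{R}^+$ satisfy $\omega(k)\to\infty$ as $k\to\infty$. There exists an integer $k_0=k_0(\varepsilon,\omega)$ such that the following holds. Suppose $k_0<k\le n$, $p\ge \frac{\omega(k)}{k}$, and $G=G(X,Y)$ is a bipartite graph with $|X|=k$, $|Y|=n$ which is Thomason pseudorandom with parameters $(p,\varepsilon)$. Then $G$ is $(f,g,\varepsilon)$-NMP-approximable, where (a) $f(x)=O(x)$ and $g(x)=O(\sqrt{x})$ if $n>\frac{k}{\sqrt{\varepsilon}}$, and (b) $f(x)=g(x)=O\!\left(\sqrt[4]{x}\,\log\frac{1}{x}\right)$ if $n\le \frac{k}{\sqrt{\varepsilon}}$. (Here the implied constants in the $O(\cdot)$ are absolute.)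
   Context: A bipartite graph $G(X,Y)$ with $|X|=k\le n=|Y|$ is Thomason pseudorandom with parameters $(p,\varepsilon)$ (where $0<p<1$, $0\le\varepsilon<1$) if every vertex of $X$ has degree at least $pn$ and every pair of distinct vertices of $X$ has at most $(1+\varepsilon)p^2n$ common neighbours. A bipartite graph $G(X,Y)$ has the Normalized Matching Property (NMP) if for every $S\subseteq X$, $\frac{|N(S)|}{|Y|}\ge\frac{|S|}{|X|}$, where $N(S)\subseteq Y$ is the neighbourhood of $S$. For functions $f,g:\mathbb{R}^+\to\mathbb{R}^+$ with $f(x),g(x)\to 0$ as $x\to 0$, $G(X,Y)$ is $(f,g,\varepsilon)$-NMP-approximable if there are subsets $\tilde X\subseteq X$, $\tilde Y\subseteq Y$ with $|\tilde X|/|X|\le f(\varepsilon)$, $|\tilde Y|/|Y|\le g(\varepsilon)$, such that the bipartite subgraph induced on $X\setminus\tilde X$ and $Y\setminus\tilde Y$ has NMP. *)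

theory Defs
  imports Complex_Main "HOL-Library.Landau_Symbols"
begin

text \<open>
  The two sides of a bipartite graph live in (possibly) different types, so they need not be
  assumed disjoint. An edge between \<open>x\<close> in \<open>X\<close> and \<open>y\<close> in \<open>Y\<close> is the pair \<open>(x, y)\<close>, so
  the neighbourhood of \<open>S \<subseteq> X\<close> is the relational image \<open>E `` S\<close>.
\<close>

definition bipartite_graph :: "'a set \<Rightarrow> 'b set \<Rightarrow> ('a \<times> 'b) set \<Rightarrow> bool" where
  "bipartite_graph X Y E \<longleftrightarrow> finite X \<and> finite Y \<and> E \<subseteq> X \<times> Y"

definition thomason_pseudorandom ::
  "real \<Rightarrow> real \<Rightarrow> 'a set \<Rightarrow> 'b set \<Rightarrow> ('a \<times> 'b) set \<Rightarrow> bool" where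
  "thomason_pseudorandom p \<epsilon> X Y E \<longleftrightarrow>
     bipartite_graph X Y E \<and> card X \<le> card Y \<and> 0 < p \<and> p < 1 \<and> 0 \<le> \<epsilon> \<and> \<epsilon> < 1 \<and>
     (\<forall>x\<in>X. p * real (card Y) \<le> real (card (E `` {x}))) \<and>
     (\<forall>x\<in>X. \<forall>x'\<in>X. x \<noteq> x' \<longrightarrow>
        real (card (E `` {x} \<inter> E `` {x'})) \<le> (1 + \<epsilon>) * p\<^sup>2 * real (card Y))"

text \<open>
  If \<open>X\<close> is empty the property holds trivially; if \<open>Y\<close> is empty and \<open>X\<close> is not, then it fails
  (take \<open>S = X\<close>, where the inequality reads \<open>1 \<le> 0\<close> because division by zero yields zero).
\<close>

definition normalized_matching_property ::
  "'a set \<Rightarrow> 'b set \<Rightarrow> ('a \<times> 'b) set \<Rightarrow> bool" where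
  "normalized_matching_property X Y E \<longleftrightarrow>
     (\<forall>S\<subseteq>X. real (card (E `` S)) / real (card Y) \<ge> real (card S) / real (card X))"

text \<open>Functions from the positive reals to the positive reals that vanish in the limit at zero;
  the values at nonpositive arguments are irrelevant.\<close>

definition error_function :: "(real \<Rightarrow> real) \<Rightarrow> bool" where
  "error_function f \<longleftrightarrow> (\<forall>x>0. f x > 0) \<and> (f \<longlongrightarrow> 0) (at_right 0)"

definition NMP_approximable ::
  "(real \<Rightarrow> real) \<Rightarrow> (real \<Rightarrow> real) \<Rightarrow> real \<Rightarrow> 'a set \<Rightarrow> 'b set \<Rightarrow> ('a \<times> 'b) set \<Rightarrow> bool" where
  "NMP_approximable f g \<epsilon> X Y E \<longleftrightarrow>
     error_function f \<and> error_function g \<and>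
     (\<exists>X'\<subseteq>X. \<exists>Y'\<subseteq>Y.
        real (card X') / real (card X) \<le> f \<epsilon> \<and>
        real (card Y') / real (card Y) \<le> g \<epsilon> \<and>
        normalized_matching_property (X - X') (Y - Y') (E \<inter> ((X - X') \<times> (Y - Y'))))"

end

theory Submission imports Defs "HOL-Real_Asymp.Real_Asymp" "HOL-Analysis.Convex" begin

text \<open>
  Among the nonempty subsets of \<open>X\<close> take \<open>S\<close> with \<open>|S| / |N(S)|\<close> maximal. Maximality says precisely
  that the graph induced on \<open>S\<close> and \<open>N(S)\<close> has the normalized matching property. Moreover
  \<open>|N(S)| / |S| \<le> n / k\<close>, whereas Cauchy--Schwarz and the codegree condition force
  \<open>|N(S)| \<ge> n / (1 + \<epsilon> + 1 / (p |S|))\<close>; hence \<open>S\<close> and \<open>N(S)\<close> miss at most proportions \<open>2\<epsilon>\<close> of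
  \<open>X\<close> and \<open>Y\<close>. So \<open>f(x) = g(x) = 2x\<close> works in both cases.
\<close>

lemma sum_card_Image_singleton:
  assumes "finite S" "finite B" "E `` S \<subseteq> B"
  shows "(\<Sum>x\<in>S. real (card (E `` {x}))) = (\<Sum>y\<in>B. real (card {x\<in>S. (x, y) \<in> E}))"
proof -
  have "(\<Sum>x\<in>S. card (E `` {x})) = (\<Sum>x\<in>S. card {y\<in>B. (x, y) \<in> E})"
    using assms(3) by (intro sum.cong refl arg_cong[where f = card]) auto
  also have "\<dots> = (\<Sum>y\<in>B. card {x\<in>S. (x, y) \<in> E})"
    using assms(1,2) by (rule sum_multicount_gen) auto
  finally show ?thesis
    unfolding of_nat_sum[symmetric] of_nat_eq_iff .
qed

text \<open>Both sides count triples of two vertices of \<open>S\<close> and a common neighbour. The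
  pairs are ordered and include \<open>x = x'\<close>, where the codegree is the degree.\<close>

lemma sum_card_codegree:
  assumes S: "finite S" and B: "finite B" and N: "E `` S \<subseteq> B"
  shows "(\<Sum>x\<in>S. \<Sum>x'\<in>S. real (card (E `` {x} \<inter> E `` {x'}))) =
    (\<Sum>y\<in>B. (real (card {x\<in>S. (x, y) \<in> E}))\<^sup>2)"
proof -
  let ?c = "\<lambda>x y. of_bool ((x, y) \<in> E) :: real"
  have deg: "real (card {x\<in>S. (x, y) \<in> E}) = (\<Sum>x\<in>S. ?c x y)" for y
    using S by (simp add: of_bool_def sum.If_cases Int_def)
  have codeg: "real (card (E `` {x} \<inter> E `` {x'})) = (\<Sum>y\<in>B. ?c x y * ?c x' y)" if "x \<in> S" for x x'
  proof -
    have "E `` {x} \<inter> E `` {x'} = {y\<in>B. (x, y) \<in> E \<and> (x', y) \<in> E}"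
      using N that by auto
    moreover have "?c x y * ?c x' y = (if (x, y) \<in> E \<and> (x', y) \<in> E then 1 else 0)" for y
      by simp
    ultimately show ?thesis
      using B by (simp only: sum.If_cases) (simp add: Int_def)
  qed
  have "(\<Sum>x\<in>S. \<Sum>x'\<in>S. real (card (E `` {x} \<inter> E `` {x'}))) =
      (\<Sum>x\<in>S. \<Sum>x'\<in>S. \<Sum>y\<in>B. ?c x y * ?c x' y)"
    using codeg by (intro sum.cong refl) auto
  also have "\<dots> = (\<Sum>x\<in>S. \<Sum>y\<in>B. \<Sum>x'\<in>S. ?c x y * ?c x' y)"
    by (intro sum.cong refl sum.swap)
  also have "\<dots> = (\<Sum>y\<in>B. \<Sum>x\<in>S. \<Sum>x'\<in>S. ?c x y * ?c x' y)"
    by (rule sum.swap)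
  also have "\<dots> = (\<Sum>y\<in>B. (real (card {x\<in>S. (x, y) \<in> E}))\<^sup>2)"
    by (simp only: deg power2_eq_square sum_product)
  finally show ?thesis .
qed

text \<open>Second moment method: few common neighbours keep the squared degrees into
  \<open>S\<close> small, so by Cauchy-Schwarz the edges at \<open>S\<close> cannot concentrate on
  few vertices of \<open>Y\<close>. Clearing denominators lets the bound cover empty
  \<open>S\<close> and \<open>Y\<close>.\<close>

lemma thomason_pseudorandom_expansion:
  assumes G: "thomason_pseudorandom p \<epsilon> X Y E" and "S \<subseteq> X"
  shows "real (card S) * p * real (card Y) \<le>
    real (card (E `` S)) * (1 + (1 + \<epsilon>) * p * real (card S))"
proof (cases "S = {} \<or> Y = {}")
  case True
  have "0 < p" "0 \<le> \<epsilon>" using G by (auto simp: thomason_pseudorandom_def)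
  with True show ?thesis by auto
next
  case False
  let ?s = "real (card S)" and ?n = "real (card Y)" and ?m = "real (card (E `` S))"
  \<comment> \<open>\<open>D\<close> is the number of edges at \<open>S\<close>, \<open>a\<close>
    its lower bound from the degree condition, and \<open>Q\<close> the codegree bound summed over
    all ordered pairs from \<open>S\<close>.\<close>
  define a where "a = ?s * p * ?n"
  define Q where "Q = ?s\<^sup>2 * ((1 + \<epsilon>) * p\<^sup>2 * ?n)"
  define D where "D = (\<Sum>x\<in>S. real (card (E `` {x})))"
  have fin: "finite X" "finite Y" and E: "E \<subseteq> X \<times> Y" and p: "0 < p" and \<epsilon>: "0 \<le> \<epsilon>"
    and deg: "\<And>x. x \<in> X \<Longrightarrow> p * ?n \<le> real (card (E `` {x}))"
    and codeg: "\<And>x x'. x \<in> X \<Longrightarrow> x' \<in> X \<Longrightarrow> x \<noteq> x' \<Longrightarrow>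
      real (card (E `` {x} \<inter> E `` {x'})) \<le> (1 + \<epsilon>) * p\<^sup>2 * ?n"
    using G by (auto simp: thomason_pseudorandom_def bipartite_graph_def)
  have finS: "finite S" using fin \<open>S \<subseteq> X\<close> by (rule_tac finite_subset)
  have finN: "finite (E `` S)" using E fin by (blast intro: finite_subset)
  have pos: "0 < ?s" "0 < ?n" using False fin finS by (auto simp: card_gt_0_iff)
  have "a \<le> D"
    unfolding D_def a_def using sum_mono[of S "\<lambda>_. p * ?n" "\<lambda>x. real (card (E `` {x}))"] deg \<open>S \<subseteq> X\<close>
    by (auto simp: mult.assoc)
  \<comment> \<open>Diagonal terms are charged both their degree and the codegree bound; this slight
    waste gives the clean total \<open>D + Q\<close>.\<close>
  have "(\<Sum>x\<in>S. \<Sum>x'\<in>S. real (card (E `` {x} \<inter> E `` {x'}))) \<le>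
      (\<Sum>x\<in>S. \<Sum>x'\<in>S. (if x' = x then real (card (E `` {x})) else 0) + (1 + \<epsilon>) * p\<^sup>2 * ?n)"
    using codeg \<open>S \<subseteq> X\<close> \<epsilon> by (intro sum_mono) auto
  also have "\<dots> = D + Q"
    using finS by (simp add: sum.distrib D_def Q_def power2_eq_square)
  finally have "(\<Sum>y\<in>E `` S. (real (card {x\<in>S. (x, y) \<in> E}))\<^sup>2) \<le> D + Q"
    using sum_card_codegree[OF finS finN order_refl] by simp
  moreover have "D\<^sup>2 \<le> (\<Sum>y\<in>E `` S. (real (card {x\<in>S. (x, y) \<in> E}))\<^sup>2) * ?m"
    unfolding D_def sum_card_Image_singleton[OF finS finN order_refl]
    by (rule sum_squared_le_sum_of_squares)
  ultimately have "D\<^sup>2 \<le> (D + Q) * ?m"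
    by (meson mult_right_mono of_nat_0_le_iff order_trans)
  have "0 < a" "0 \<le> Q" using pos p \<epsilon> by (auto simp: a_def Q_def)
  \<comment> \<open>\<open>D\<^sup>2 / (D + Q)\<close> increases with \<open>D\<close>, so \<open>D\<close> may be replaced by its lower bound \<open>a\<close>.\<close>
  have "a * a \<le> ?m * (a + Q)"
  proof (rule ccontr)
    assume less: "\<not> ?thesis"
    \<comment> \<open>Since \<open>?m * Q\<close> is nonnegative, \<open>a\<close> exceeds
      \<open>?m\<close>. Beyond \<open>?m\<close> the function t(t - \<open>?m\<close>) increases,
      so the strict inequality passes from \<open>a\<close> to \<open>D\<close>, against the
      Cauchy-Schwarz bound.\<close>
    then have "?m * Q < a * (a - ?m)" by (simp add: algebra_simps)
    moreover from this have "0 < a - ?m"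
      using \<open>0 < a\<close> \<open>0 \<le> Q\<close>
      by (metis mult_nonneg_nonneg of_nat_0_le_iff order.strict_trans1 zero_less_mult_pos)
    then have "a * (a - ?m) \<le> D * (D - ?m)"
      using \<open>a \<le> D\<close> \<open>0 < a\<close> by (intro mult_mono) auto
    ultimately show False
      using \<open>D\<^sup>2 \<le> (D + Q) * ?m\<close> by (simp add: algebra_simps power2_eq_square)
  qed
  also have "\<dots> = a * (?m * (1 + (1 + \<epsilon>) * p * ?s))"
    by (simp add: a_def Q_def algebra_simps power2_eq_square)
  finally have "a \<le> ?m * (1 + (1 + \<epsilon>) * p * ?s)" using \<open>0 < a\<close> by simp
  then show ?thesis by (simp add: a_def)
qed

lemma normalized_matching_property_of_max_ratio:
  assumes fin: "finite X" "finite Y" and E: "E \<subseteq> X \<times> Y" and "X \<noteq> {}"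
    and nbr: "\<And>x. x \<in> X \<Longrightarrow> E `` {x} \<noteq> {}"
  obtains S where "S \<subseteq> X" "S \<noteq> {}"
    "real (card X) * real (card (E `` S)) \<le> real (card S) * real (card Y)"
    "normalized_matching_property S (E `` S) (E \<inter> S \<times> E `` S)"
proof -
  define r where "r A = real (card A) / real (card (E `` A))" for A
  let ?P = "r ` (Pow X - {{}})"
  have P: "finite ?P" "?P \<noteq> {}" using fin \<open>X \<noteq> {}\<close> by auto
  obtain S where "S \<in> Pow X - {{}}" and "r S = Max ?P"
    using Max_in[OF P] by (rule imageE) simp
  then have S: "S \<subseteq> X" "S \<noteq> {}" by auto
  have max: "r A \<le> r S" if "A \<subseteq> X" "A \<noteq> {}" for A
    unfolding \<open>r S = Max ?P\<close> using that by (intro Max_ge P) auto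
  \<comment> \<open>An empty neighbourhood would make \<open>r A\<close> equal to 0 by the
    convention for division by zero, and maximality would then say nothing about
    \<open>A\<close>.\<close>
  have N_pos: "0 < card (E `` A)" if "A \<subseteq> X" "A \<noteq> {}" for A
  proof -
    have "finite (E `` A)" using E fin by (blast intro: finite_subset)
    moreover have "E `` A \<noteq> {}" using nbr that by blast
    ultimately show ?thesis by (simp add: card_gt_0_iff)
  qed
  have S_pos: "0 < card S" using S fin by (simp add: card_gt_0_iff finite_subset)
  have ratio: "real (card A) * real (card (E `` S)) \<le> real (card S) * real (card (E `` A))"
    if "A \<subseteq> X" for A
    using max[OF that] N_pos[OF that] N_pos[OF S] by (cases "A = {}") (auto simp: r_def field_simps)
  show ?thesis
  proof (rule that[OF S])
    have "E `` X \<subseteq> Y" using E by auto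
    then have "real (card (E `` X)) \<le> real (card Y)" using fin by (simp add: card_mono)
    \<comment> \<open>Here \<open>S\<close> competes with the whole of \<open>X\<close>; for the
      matching property it competes with its own subsets.\<close>
    with ratio[of X] show "real (card X) * real (card (E `` S)) \<le> real (card S) * real (card Y)"
      by (meson mult_left_mono of_nat_0_le_iff order.trans order_refl)
    show "normalized_matching_property S (E `` S) (E \<inter> S \<times> E `` S)"
      unfolding normalized_matching_property_def
    proof (intro allI impI)
      fix A assume "A \<subseteq> S"
      then have "(E \<inter> S \<times> E `` S) `` A = E `` A" by auto
      with ratio[of A] \<open>A \<subseteq> S\<close> S N_pos[OF S] S_pos
      show "real (card ((E \<inter> S \<times> E `` S) `` A)) / real (card (E `` S)) \<ge> real (card A) / real (card S)"
        by (simp add: field_simps)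
    qed
  qed
qed

lemma error_function_double: "error_function (\<lambda>x. 2 * x)"
  unfolding error_function_def by (intro conjI allI impI, simp, real_asymp)

lemma thomason_pseudorandom_NMP_approximable:
  assumes G: "thomason_pseudorandom p \<epsilon> X Y E" and "0 < \<epsilon>"
    and pk: "p * real (card X) \<ge> 2 / \<epsilon> + 1"
  shows "NMP_approximable (\<lambda>x. 2 * x) (\<lambda>x. 2 * x) \<epsilon> X Y E"
proof -
  let ?k = "real (card X)" and ?n = "real (card Y)"
  have fin: "finite X" "finite Y" and E: "E \<subseteq> X \<times> Y" and p: "0 < p" and \<epsilon>: "\<epsilon> < 1"
    and kn: "card X \<le> card Y" and deg: "\<And>x. x \<in> X \<Longrightarrow> p * ?n \<le> real (card (E `` {x}))"
    using G by (auto simp: thomason_pseudorandom_def bipartite_graph_def)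
  have "0 < p * ?k" using pk \<open>0 < \<epsilon>\<close> by (smt (verit) divide_pos_pos)
  then have k: "0 < ?k" using p by (simp add: zero_less_mult_iff)
  then have n: "0 < ?n" using kn by simp
  have "E `` {x} \<noteq> {}" if "x \<in> X" for x
    using deg[OF that] mult_pos_pos[OF p n] by auto
  moreover have "X \<noteq> {}" using k by auto
  ultimately obtain S where S: "S \<subseteq> X" "S \<noteq> {}" and ratio: "?k * real (card (E `` S)) \<le> real (card S) * ?n"
    and NMP: "normalized_matching_property S (E `` S) (E \<inter> S \<times> E `` S)"
    using normalized_matching_property_of_max_ratio[OF fin E] by metis
  let ?s = "real (card S)" and ?m = "real (card (E `` S))"
  have s: "0 < ?s" using S fin by (simp add: card_gt_0_iff finite_subset)
  have exp: "?s * p * ?n \<le> ?m * (1 + (1 + \<epsilon>) * p * ?s)"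
    by (rule thomason_pseudorandom_expansion[OF G S(1)])
  have NY: "E `` S \<subseteq> Y" using E by auto
  have sk: "?s \<le> ?k" using S fin by (simp add: card_mono)

  \<comment> \<open>Expansion bounds \<open>?m\<close> from below and \<open>ratio\<close> bounds it
    from above; eliminating \<open>?m\<close> forces \<open>S\<close> to be large.\<close>
  have "?k * (?s * p * ?n) \<le> (?s * ?n) * (1 + (1 + \<epsilon>) * p * ?s)"
  proof -
    have "?k * (?s * p * ?n) \<le> (?k * ?m) * (1 + (1 + \<epsilon>) * p * ?s)"
      using mult_left_mono[OF exp, of ?k] by (simp add: mult.assoc)
    also have "\<dots> \<le> (?s * ?n) * (1 + (1 + \<epsilon>) * p * ?s)"
      using p \<open>0 < \<epsilon>\<close> by (intro mult_right_mono[OF ratio]) simp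
    finally show ?thesis .
  qed
  then have "(?s * ?n) * (p * ?k) \<le> (?s * ?n) * (1 + (1 + \<epsilon>) * p * ?s)"
    by (simp add: algebra_simps)
  then have *: "p * ?k \<le> 1 + (1 + \<epsilon>) * (p * ?s)"
    using s n by (simp add: mult_le_cancel_left mult.assoc)
  \<comment> \<open>With \<epsilon> < 1 the previous bound gives
    \<open>p * ?k \<le> 1 + 2 * (p * ?s)\<close>, so the threshold \<open>2 / \<epsilon> + 1\<close>
    is what yields \<open>p * ?s \<ge> 1 / \<epsilon>\<close>. The additive 1 is then absorbed at
    the cost of a second \<epsilon>, whence the factor 2.\<close>
  have "\<epsilon> * (p * ?s) \<le> p * ?s" using \<epsilon> p s by simp
  then have "1 / \<epsilon> \<le> p * ?s" using * pk by (simp add: algebra_simps)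
  then have ps: "1 \<le> \<epsilon> * (p * ?s)" using \<open>0 < \<epsilon>\<close> by (simp add: field_simps)
  have "p * (?k - ?s) \<le> p * (2 * \<epsilon> * ?s)"
    using * ps by (simp add: algebra_simps)
  then have "?k - ?s \<le> 2 * \<epsilon> * ?s" using p by simp
  also have "\<dots> \<le> 2 * \<epsilon> * ?k" using sk \<open>0 < \<epsilon>\<close> by simp
  finally have X': "real (card (X - S)) \<le> 2 * \<epsilon> * ?k"
    using S fin by (simp add: card_Diff_subset finite_subset card_mono)

  \<comment> \<open>The same absorption, now applied to the expansion bound itself, controls the
    loss in \<open>Y\<close>.\<close>
  have "(p * ?s) * ?n \<le> ?m * ((1 + 2 * \<epsilon>) * (p * ?s))"
    using order_trans[OF exp mult_left_mono[of _ "(1 + 2 * \<epsilon>) * (p * ?s)"]] ps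
    by (simp add: algebra_simps)
  then have "(p * ?s) * ?n \<le> (p * ?s) * ((1 + 2 * \<epsilon>) * ?m)" by (simp add: mult_ac)
  then have "?n \<le> (1 + 2 * \<epsilon>) * ?m" using p s by simp
  moreover have mn: "?m \<le> ?n" using NY fin by (simp add: card_mono)
  then have "2 * \<epsilon> * ?m \<le> 2 * \<epsilon> * ?n" using \<open>0 < \<epsilon>\<close> by simp
  ultimately have "?n - ?m \<le> 2 * \<epsilon> * ?n" by (simp add: algebra_simps)
  then have Y': "real (card (Y - E `` S)) \<le> 2 * \<epsilon> * ?n"
    using NY fin by (simp add: card_Diff_subset finite_subset card_mono)

  have "X - (X - S) = S" "Y - (Y - E `` S) = E `` S" using S NY by auto
  moreover have "real (card (X - S)) / ?k \<le> 2 * \<epsilon>" "real (card (Y - E `` S)) / ?n \<le> 2 * \<epsilon>"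
    using X' Y' k n by (simp_all add: divide_le_eq)
  ultimately show ?thesis
    unfolding NMP_approximable_def using NMP error_function_double
    by (intro conjI exI[of _ "X - S"] exI[of _ "Y - E `` S"]) auto
qed

theorem theorem1p4:
  "\<exists>f\<^sub>a g\<^sub>a f\<^sub>b :: real \<Rightarrow> real.
     error_function f\<^sub>a \<and> error_function g\<^sub>a \<and> error_function f\<^sub>b \<and>
     f\<^sub>a \<in> O[at_right 0](\<lambda>x. x) \<and>
     g\<^sub>a \<in> O[at_right 0](\<lambda>x. sqrt x) \<and>
     f\<^sub>b \<in> O[at_right 0](\<lambda>x. root 4 x * ln (1 / x)) \<and>
     (\<forall>(\<epsilon>::real) (\<omega>::nat \<Rightarrow> real).
        0 < \<epsilon> \<and> \<epsilon> < 1 \<and> (\<forall>k. \<omega> k > 0) \<and> filterlim \<omega> at_top sequentially \<longrightarrow>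
        (\<exists>k\<^sub>0::nat. \<forall>(k::nat) (n::nat) (p::real) (X::'a set) (Y::'b set) (E::('a \<times> 'b) set).
           k\<^sub>0 < k \<and> k \<le> n \<and> p \<ge> \<omega> k / real k \<and>
           bipartite_graph X Y E \<and> card X = k \<and> card Y = n \<and>
           thomason_pseudorandom p \<epsilon> X Y E \<longrightarrow>
             (real n > real k / sqrt \<epsilon> \<longrightarrow> NMP_approximable f\<^sub>a g\<^sub>a \<epsilon> X Y E) \<and>
             (real n \<le> real k / sqrt \<epsilon> \<longrightarrow> NMP_approximable f\<^sub>b f\<^sub>b \<epsilon> X Y E)))"
proof -
  let ?f = "\<lambda>x::real. 2 * x"
  \<comment> \<open>Near 0 the linear function is dominated by each of the three rates, so one
    witness serves for all.\<close>
  have O: "?f \<in> O[at_right 0](\<lambda>x. x)" "?f \<in> O[at_right 0](\<lambda>x. sqrt x)"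
    "?f \<in> O[at_right 0](\<lambda>x. root 4 x * ln (1 / x))"
    by real_asymp+
  have main: "\<exists>k\<^sub>0::nat. \<forall>(k::nat) (n::nat) (p::real) (X::'a set) (Y::'b set) (E::('a \<times> 'b) set).
      k\<^sub>0 < k \<and> k \<le> n \<and> p \<ge> \<omega> k / real k \<and>
      bipartite_graph X Y E \<and> card X = k \<and> card Y = n \<and> thomason_pseudorandom p \<epsilon> X Y E \<longrightarrow>
      NMP_approximable ?f ?f \<epsilon> X Y E"
    if "0 < \<epsilon>" and \<omega>: "filterlim \<omega> at_top sequentially" for \<epsilon> :: real and \<omega> :: "nat \<Rightarrow> real"
  proof -
    \<comment> \<open>\<open>K\<close> depends only on \<epsilon> and \<omega>; beyond it
      \<open>p * k \<ge> \<omega> k\<close> reaches the threshold of the preceding lemma.\<close>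
    obtain K where K: "\<And>k. k \<ge> K \<Longrightarrow> 2 / \<epsilon> + 1 \<le> \<omega> k"
      using \<omega> unfolding filterlim_at_top eventually_sequentially by metis
    show ?thesis
    proof (intro exI[of _ K] allI impI, elim conjE)
      fix k n :: nat and p :: real and X :: "'a set" and Y :: "'b set" and E :: "('a \<times> 'b) set"
      assume "K < k" and p: "\<omega> k / real k \<le> p" and "card X = k"
        and G: "thomason_pseudorandom p \<epsilon> X Y E"
      have "2 / \<epsilon> + 1 \<le> \<omega> k" using K \<open>K < k\<close> by simp
      also have "\<dots> \<le> p * real k" using p \<open>K < k\<close> by (simp add: divide_le_eq)
      finally show "NMP_approximable ?f ?f \<epsilon> X Y E"
        using thomason_pseudorandom_NMP_approximable[OF G \<open>0 < \<epsilon>\<close>] \<open>card X = k\<close> by simp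
    qed
  qed
  show ?thesis
  proof (intro exI[of _ ?f] conjI allI impI error_function_double O, goal_cases)
    case (1 \<epsilon> \<omega>)
    then obtain k\<^sub>0 where k\<^sub>0: "\<forall>(k::nat) (n::nat) (p::real) (X::'a set) (Y::'b set) (E::('a \<times> 'b) set).
        k\<^sub>0 < k \<and> k \<le> n \<and> p \<ge> \<omega> k / real k \<and>
        bipartite_graph X Y E \<and> card X = k \<and> card Y = n \<and> thomason_pseudorandom p \<epsilon> X Y E \<longrightarrow>
        NMP_approximable ?f ?f \<epsilon> X Y E"
      using main[of \<epsilon> \<omega>] by metis
    show ?case
      by (intro exI[of _ k\<^sub>0] allI impI conjI) (rule k\<^sub>0[rule_format], assumption)+
  qed
qed

end
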